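(* Let $\mathcal{P}$ be a well-formed tail-recursive integer program and let $\alpha_1,\alpha_2\in\mathcal{P}$ with \[ \alpha_1: f_1(\vec x)\xrightarrow{c_1}f_2(\vec x)\mu\ [\varphi_1],\qquad \alpha_2: f_2(\vec x)\xrightarrow{c_2}t\ [\varphi_2], \] where $\mathcal{TV}(\alpha_1)\cap\mathcal{TV}(\alpha_2)=\emptyset$. Let $\alpha_{1.2}$ be the rule $f_1(\vec x)\xrightarrow{c_1+c_2\mu}t\mu\ [\varphi_1\land\varphi_2\mu]$ and $\mathcal{P}'=\mathcal{P}\cup\{\alpha_{1.2}\}$. Then $\mathcal{P}'$ is well formed and the processor mapping $\mathcal{P}$ to $\mathcal{P}'$ is sound.
   Context: Fix a finite set $\Sigma$ of function symbols of common arity $k$ containing a start symbol $f_0$, and variables ranging over $\mathbb{Z}$. Arithmetic expressions are built from variables, numbers and operations such as $+,-,\cdot$, division, exponentiation; a constraint is a finite conjunction of inequations between arithmetic expressions. A rule has the form $f(\vec x)\xrightarrow{c}T\ [\varphi]$ where $\vec x=(x_1,\dots,x_k)$ is a fixed vector of pairwise different program variables, $f\in\Sigma$, $c$ is an arithmetic expression (cost), $T$ a finite multiset of terms $g(t_1,\dots,t_k)$ ($g\in\Sigma$, $t_i$ arithmetic expressions), and $\varphi$ a constraint (guard); a single term $t$ on a right-hand side stands for $\{t\}$. $\mathcal{TV}(\alpha)$ denotes the variables of $\alpha$ not in $\vec x$ (temporary variables). An integer program is a finite set of rules in which $f_0$ does not occur on right-hand sides; it is tail-recursive if every right-hand side has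 at most one element. Substitutions map variables to arithmetic expressions, applied homomorphically ($t\mu$); $f_2(\vec x)\mu$ is the term $f_2(x_1\mu,\dots,x_k\mu)$. An integer substitution maps variables of its domain to integers; $\sigma\models\alpha$ means all variables of $\alpha$ lie in $\mathrm{dom}(\sigma)$ and $\sigma$ models the guard. A configuration is a finite multiset of terms $f(n_1,\dots,n_k)$, $n_i\in\mathbb{Z}$. $S\xrightarrow{k}_{\mathcal{P}}T$ if there are $s\in S$, a rule $f(\vec x)\xrightarrow{c}Q\ [\varphi]$ in $\mathcal{P}$ and an integer substitution $\sigma$ covering the rule's variables with $f(\vec x)\sigma=s$, $\sigma\models\varphi$, $c\sigma=k$, $T=(S\setminus\{s\})\cup Q\sigma$ (equality modulo arithmetic); costs of sequences are summed. $\mathrm{dh}_{\mathcal{P}}(S)=\sup\{k\mid S\xrightarrow{k}{}^{*}_{\mathcal{P}}T\}$, $\mathrm{rc}_{\mathcal{P}}(n)=\sup\{\mathrm{dh}_{\mathcal{P}}(f_0(\vec n))\mid\vec n\in\mathbb{Z}^k,\sum_i|n_i|\leq n\}$. A rule $\alpha$ is well formed if $t_i\sigma\in\mathbb{Z}$ for all $f(t_1,\dots,t_k)\in\mathrm{rhs}(\alpha)$, all $i$ and all integer substitutions $\sigma\models\alpha$; a program is well formed if all its rules are. A processor is a partial function on integer programs; it is sound if $\mathrm{rc}_{\mathcal{P}}(n)\geq\mathrm{rc}_{\mathrm{proc}(\mathcal{P})}(n)$ for all $n\in\mathbb{N}$ and all $\mathcal{P}$ where it is defined.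
   Formalization: The substitution μ is required to change only program variables in the vector x; if μ could also map a temporary variable of α₂ (say to 1/2), the chained rule could be ill formed and the claim would fail. *)

theory Defs
  imports Complex_Main "HOL-Library.Multiset" "HOL-Library.Extended_Real"
begin

datatype (vars_aexp: 'v) aexp =
    Var 'v
  | Num real
  | Add "'v aexp" "'v aexp"
  | Sub "'v aexp" "'v aexp"
  | Mul "'v aexp" "'v aexp"
  | Div "'v aexp" "'v aexp"
  | Pow "'v aexp" "'v aexp"

text \<open>Evaluation is partial: division by zero, and powers without a real value, have no value
  (rather than the default values of HOL), so they satisfy no inequation and are not integers.\<close>

definition div_val :: "real \<Rightarrow> real \<Rightarrow> real option" where
  "div_val a b = (if b = 0 then None else Some (a / b))"

definition pow_val :: "real \<Rightarrow> real \<Rightarrow> real option" where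
  "pow_val a b =
     (if a > 0 then Some (a powr b)
      else if a = 0 then (if b > 0 then Some 0 else if b = 0 then Some 1 else None)
      else if b \<in> \<int> then Some (a powi \<lfloor>b\<rfloor>)
      else None)"

definition lift2 :: "(real \<Rightarrow> real \<Rightarrow> real option) \<Rightarrow> real option \<Rightarrow> real option \<Rightarrow> real option" where
  "lift2 h u v = Option.bind u (\<lambda>a. Option.bind v (\<lambda>b. h a b))"

type_synonym 'v int_subst = "'v \<rightharpoonup> int"

primrec aeval :: "'v int_subst \<Rightarrow> 'v aexp \<Rightarrow> real option" where
  "aeval \<sigma> (Var x) = map_option real_of_int (\<sigma> x)"
| "aeval \<sigma> (Num r) = Some r"
| "aeval \<sigma> (Add a b) = lift2 (\<lambda>u v. Some (u + v)) (aeval \<sigma> a) (aeval \<sigma> b)"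
| "aeval \<sigma> (Sub a b) = lift2 (\<lambda>u v. Some (u - v)) (aeval \<sigma> a) (aeval \<sigma> b)"
| "aeval \<sigma> (Mul a b) = lift2 (\<lambda>u v. Some (u * v)) (aeval \<sigma> a) (aeval \<sigma> b)"
| "aeval \<sigma> (Div a b) = lift2 div_val (aeval \<sigma> a) (aeval \<sigma> b)"
| "aeval \<sigma> (Pow a b) = lift2 pow_val (aeval \<sigma> a) (aeval \<sigma> b)"

type_synonym 'v subst = "'v \<Rightarrow> 'v aexp"

definition subst_dom :: "'v subst \<Rightarrow> 'v set" where
  "subst_dom \<mu> = {x. \<mu> x \<noteq> Var x}"

primrec subst_aexp :: "'v subst \<Rightarrow> 'v aexp \<Rightarrow> 'v aexp" where
  "subst_aexp \<mu> (Var x) = \<mu> x"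
| "subst_aexp \<mu> (Num r) = Num r"
| "subst_aexp \<mu> (Add a b) = Add (subst_aexp \<mu> a) (subst_aexp \<mu> b)"
| "subst_aexp \<mu> (Sub a b) = Sub (subst_aexp \<mu> a) (subst_aexp \<mu> b)"
| "subst_aexp \<mu> (Mul a b) = Mul (subst_aexp \<mu> a) (subst_aexp \<mu> b)"
| "subst_aexp \<mu> (Div a b) = Div (subst_aexp \<mu> a) (subst_aexp \<mu> b)"
| "subst_aexp \<mu> (Pow a b) = Pow (subst_aexp \<mu> a) (subst_aexp \<mu> b)"

datatype ineq_rel = LT | LE | GT | GE

primrec rel_holds :: "ineq_rel \<Rightarrow> real \<Rightarrow> real \<Rightarrow> bool" where
  "rel_holds LT a b = (a < b)"
| "rel_holds LE a b = (a \<le> b)"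
| "rel_holds GT a b = (a > b)"
| "rel_holds GE a b = (a \<ge> b)"

datatype (vars_ineq: 'v) ineq = Ineq ineq_rel "'v aexp" "'v aexp"

primrec subst_ineq :: "'v subst \<Rightarrow> 'v ineq \<Rightarrow> 'v ineq" where
  "subst_ineq \<mu> (Ineq r a b) = Ineq r (subst_aexp \<mu> a) (subst_aexp \<mu> b)"

primrec ineq_holds :: "'v int_subst \<Rightarrow> 'v ineq \<Rightarrow> bool" where
  "ineq_holds \<sigma> (Ineq r a b) \<longleftrightarrow>
     (\<exists>u v. aeval \<sigma> a = Some u \<and> aeval \<sigma> b = Some v \<and> rel_holds r u v)"

text \<open>A constraint is the conjunction of the inequations in a list.\<close>

type_synonym 'v constraint = "'v ineq list"

definition subst_constraint :: "'v subst \<Rightarrow> 'v constraint \<Rightarrow> 'v constraint" where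
  "subst_constraint \<mu> \<phi> = map (subst_ineq \<mu>) \<phi>"

definition constraint_holds :: "'v int_subst \<Rightarrow> 'v constraint \<Rightarrow> bool" where
  "constraint_holds \<sigma> \<phi> \<longleftrightarrow> (\<forall>q \<in> set \<phi>. ineq_holds \<sigma> q)"

type_synonym ('f, 'v) fterm = "'f \<times> 'v aexp list"

definition subst_fterm :: "'v subst \<Rightarrow> ('f, 'v) fterm \<Rightarrow> ('f, 'v) fterm" where
  "subst_fterm \<mu> t = (fst t, map (subst_aexp \<mu>) (snd t))"

text \<open>The left-hand side of every rule is its root symbol applied to the fixed vector of program
  variables; that vector is the parameter \<open>xs\<close> below, and the common arity is its length.\<close>

datatype ('f, 'v) rule =
  Rule (root: 'f) (cost: "'v aexp") (rhs: "('f, 'v) fterm multiset") (guard: "'v constraint")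

type_synonym ('f, 'v) program = "('f, 'v) rule set"

definition vars_rule :: "'v list \<Rightarrow> ('f, 'v) rule \<Rightarrow> 'v set" where
  "vars_rule xs \<alpha> =
     set xs \<union> vars_aexp (cost \<alpha>)
     \<union> (\<Union>t \<in> set_mset (rhs \<alpha>). \<Union>e \<in> set (snd t). vars_aexp e)
     \<union> (\<Union>q \<in> set (guard \<alpha>). vars_ineq q)"

definition temp_vars :: "'v list \<Rightarrow> ('f, 'v) rule \<Rightarrow> 'v set" where
  "temp_vars xs \<alpha> = vars_rule xs \<alpha> - set xs"

definition integer_program :: "'f set \<Rightarrow> 'f \<Rightarrow> 'v list \<Rightarrow> ('f, 'v) program \<Rightarrow> bool" where
  "integer_program Sig f0 xs P \<longleftrightarrow>
     finite P \<and>
     (\<forall>\<alpha> \<in> P. root \<alpha> \<in> Sig \<and>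
        (\<forall>(g, ts) \<in># rhs \<alpha>. g \<in> Sig \<and> g \<noteq> f0 \<and> length ts = length xs))"

definition tail_recursive :: "('f, 'v) program \<Rightarrow> bool" where
  "tail_recursive P \<longleftrightarrow> (\<forall>\<alpha> \<in> P. size (rhs \<alpha>) \<le> 1)"

definition models_rule :: "'v list \<Rightarrow> 'v int_subst \<Rightarrow> ('f, 'v) rule \<Rightarrow> bool" where
  "models_rule xs \<sigma> \<alpha> \<longleftrightarrow> vars_rule xs \<alpha> \<subseteq> dom \<sigma> \<and> constraint_holds \<sigma> (guard \<alpha>)"

definition well_formed_rule :: "'v list \<Rightarrow> ('f, 'v) rule \<Rightarrow> bool" where
  "well_formed_rule xs \<alpha> \<longleftrightarrow>
     (\<forall>\<sigma>. models_rule xs \<sigma> \<alpha> \<longrightarrow>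
        (\<forall>(g, ts) \<in># rhs \<alpha>. \<forall>t \<in> set ts. \<exists>n :: int. aeval \<sigma> t = Some (real_of_int n)))"

definition well_formed :: "'v list \<Rightarrow> ('f, 'v) program \<Rightarrow> bool" where
  "well_formed xs P \<longleftrightarrow> (\<forall>\<alpha> \<in> P. well_formed_rule xs \<alpha>)"

type_synonym 'f config = "('f \<times> int list) multiset"

text \<open>The equation between the two images says that \<open>Q\<close> is the instance of the right-hand side
  modulo arithmetic, all of whose arguments have to evaluate to integers.\<close>

definition step ::
    "'v list \<Rightarrow> ('f, 'v) program \<Rightarrow> 'f config \<Rightarrow> real \<Rightarrow> 'f config \<Rightarrow> bool" where
  "step xs P S k T \<longleftrightarrow>
     (\<exists>s \<in># S. \<exists>\<alpha> \<in> P. \<exists>\<sigma> Q.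
        root \<alpha> = fst s \<and> map \<sigma> xs = map Some (snd s) \<and>
        models_rule xs \<sigma> \<alpha> \<and>
        aeval \<sigma> (cost \<alpha>) = Some k \<and>
        image_mset (\<lambda>(g, ts). (g, map (aeval \<sigma>) ts)) (rhs \<alpha>) =
          image_mset (\<lambda>(g, ns). (g, map (\<lambda>n. Some (real_of_int n)) ns)) Q \<and>
        T = S - {#s#} + Q)"

inductive steps ::
    "'v list \<Rightarrow> ('f, 'v) program \<Rightarrow> 'f config \<Rightarrow> real \<Rightarrow> 'f config \<Rightarrow> bool"
  for xs :: "'v list" and P :: "('f, 'v) program" where
  steps_refl: "steps xs P S 0 S"
| steps_step: "step xs P S k T \<Longrightarrow> steps xs P T l U \<Longrightarrow> steps xs P S (k + l) U"

definition dh :: "'v list \<Rightarrow> ('f, 'v) program \<Rightarrow> 'f config \<Rightarrow> ereal" where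
  "dh xs P S = Sup {ereal k | k. \<exists>T. steps xs P S k T}"

definition rc :: "'f \<Rightarrow> 'v list \<Rightarrow> ('f, 'v) program \<Rightarrow> nat \<Rightarrow> ereal" where
  "rc f0 xs P n =
     Sup {dh xs P {#(f0, ns)#} | ns. length ns = length xs \<and> (\<Sum>m\<leftarrow>ns. \<bar>m\<bar>) \<le> int n}"

definition processor ::
    "'f set \<Rightarrow> 'f \<Rightarrow> 'v list \<Rightarrow> (('f, 'v) program \<rightharpoonup> ('f, 'v) program) \<Rightarrow> bool" where
  "processor Sig f0 xs proc \<longleftrightarrow>
     (\<forall>P P'. proc P = Some P' \<longrightarrow> integer_program Sig f0 xs P \<and> integer_program Sig f0 xs P')"

definition sound_processor ::
    "'f \<Rightarrow> 'v list \<Rightarrow> (('f, 'v) program \<rightharpoonup> ('f, 'v) program) \<Rightarrow> bool" where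
  "sound_processor f0 xs proc \<longleftrightarrow>
     (\<forall>P P'. proc P = Some P' \<longrightarrow> (\<forall>n. rc f0 xs P n \<ge> rc f0 xs P' n))"

end

theory Submission imports Defs begin

text \<open>A step with the chained rule under \<open>\<sigma>\<close> is simulated by a step with the first rule followed by
  a step with the second one under the substitution that maps each program variable \<open>x\<close> to the
  value of \<open>\<mu> x\<close> under \<open>\<sigma>\<close> and agrees with \<open>\<sigma>\<close> elsewhere. Well-formedness of the first rule is what
  makes these values integers. The chained rule may contain fewer variables than the first rule
  (when \<open>x\<close> does not occur in the second rule, the variables of \<open>\<mu> x\<close> may get lost), so \<open>\<sigma>\<close> is first
  extended to a total substitution.\<close>

lemma aeval_cong:
  "(\<And>x. x \<in> vars_aexp e \<Longrightarrow> \<sigma> x = \<tau> x) \<Longrightarrow> aeval \<sigma> e = aeval \<tau> e"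
  by (induction e) simp_all

lemma ineq_holds_cong:
  "(\<And>x. x \<in> vars_ineq q \<Longrightarrow> \<sigma> x = \<tau> x) \<Longrightarrow> ineq_holds \<sigma> q = ineq_holds \<tau> q"
  by (cases q) (simp add: aeval_cong[of _ \<sigma> \<tau>])

text \<open>The substitution lemma, with \<open>\<tau>\<close> as the composition of
  \<open>\<mu>\<close> and evaluation under \<open>\<sigma>\<close>. Being an equation of options,
  it transfers undefinedness as well as values.\<close>

lemma aeval_subst_aexp:
  assumes "\<And>x. x \<in> vars_aexp e \<Longrightarrow> aeval \<sigma> (\<mu> x) = map_option real_of_int (\<tau> x)"
  shows "aeval \<sigma> (subst_aexp \<mu> e) = aeval \<tau> e"
  using assms by (induction e) auto

lemma ineq_holds_subst_ineq:
  assumes "\<And>x. aeval \<sigma> (\<mu> x) = map_option real_of_int (\<tau> x)"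
  shows "ineq_holds \<sigma> (subst_ineq \<mu> q) = ineq_holds \<tau> q"
  using aeval_subst_aexp[OF assms] by (cases q) simp

text \<open>The value 0 is arbitrary: it reaches only variables outside the domain, so expressions
  over the domain keep their values.\<close>

definition total_ext :: "'v int_subst \<Rightarrow> 'v int_subst" where
  "total_ext \<sigma> x = (case \<sigma> x of None \<Rightarrow> Some 0 | Some n \<Rightarrow> Some n)"

lemma dom_total_ext [simp]: "dom (total_ext \<sigma>) = UNIV"
  by (auto simp: total_ext_def dom_def split: option.splits)

lemma total_ext_eq: "x \<in> dom \<sigma> \<Longrightarrow> total_ext \<sigma> x = \<sigma> x"
  by (auto simp: total_ext_def)

lemma aeval_total_ext: "vars_aexp e \<subseteq> dom \<sigma> \<Longrightarrow> aeval (total_ext \<sigma>) e = aeval \<sigma> e"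
  by (rule aeval_cong) (auto intro!: total_ext_eq)

lemma ineq_holds_total_ext:
  "vars_ineq q \<subseteq> dom \<sigma> \<Longrightarrow> ineq_holds (total_ext \<sigma>) q = ineq_holds \<sigma> q"
  by (rule ineq_holds_cong) (auto intro!: total_ext_eq)

text \<open>Only \<open>\<beta>\<close> is instantiated by \<open>\<mu>\<close>; the link between
  the right-hand side of \<open>\<alpha>\<close> and the root of \<open>\<beta>\<close> is a
  hypothesis of the lemma on steps.\<close>

definition chain_rule :: "'v subst \<Rightarrow> ('f, 'v) rule \<Rightarrow> ('f, 'v) rule \<Rightarrow> ('f, 'v) rule" where
  "chain_rule \<mu> \<alpha> \<beta> = Rule (root \<alpha>) (Add (cost \<alpha>) (subst_aexp \<mu> (cost \<beta>)))
     (image_mset (subst_fterm \<mu>) (rhs \<beta>)) (guard \<alpha> @ subst_constraint \<mu> (guard \<beta>))"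

lemma models_chain_ruleE:
  fixes xs :: "'v list"
  assumes wf: "well_formed_rule xs \<alpha>"
    and rhs: "rhs \<alpha> = {#subst_fterm \<mu> (g, map Var xs)#}"
    and dom: "subst_dom \<mu> \<subseteq> set xs"
    and mod: "models_rule xs \<sigma> (chain_rule \<mu> \<alpha> \<beta>)"
  obtains \<tau> where "models_rule xs (total_ext \<sigma>) \<alpha>" and "models_rule xs \<tau> \<beta>"
    and "\<And>x. aeval (total_ext \<sigma>) (\<mu> x) = map_option real_of_int (\<tau> x)"
    and "dom \<tau> = UNIV"
proof -
  have vars: "vars_rule xs (chain_rule \<mu> \<alpha> \<beta>) \<subseteq> dom \<sigma>"
    and guards: "constraint_holds \<sigma> (guard (chain_rule \<mu> \<alpha> \<beta>))"
    using mod by (auto simp: models_rule_def)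
  have guards': "ineq_holds (total_ext \<sigma>) q"
    if "q \<in> set (guard (chain_rule \<mu> \<alpha> \<beta>))" for q
  proof -
    have "vars_ineq q \<subseteq> dom \<sigma>" using vars that by (auto simp: vars_rule_def)
    then show ?thesis using guards that
      by (simp add: constraint_holds_def ineq_holds_total_ext)
  qed
  \<comment> \<open>The guard of \<open>\<alpha>\<close> is the first part of the chained guard, and
    totality covers those variables of \<open>\<alpha>\<close> that the chained rule has
    lost.\<close>
  have m1: "models_rule xs (total_ext \<sigma>) \<alpha>"
    using guards' by (auto simp: models_rule_def constraint_holds_def chain_rule_def)
  have ints: "\<exists>n :: int. aeval (total_ext \<sigma>) (\<mu> x) = Some (real_of_int n)" for x
  proof (cases "x \<in> set xs")
    case True
    \<comment> \<open>For a program variable \<open>x\<close>, \<open>\<mu> x\<close> is an argument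
      on the right-hand side of \<open>\<alpha>\<close>, so well-formedness applies.\<close>
    then show ?thesis using wf m1 rhs by (auto simp: well_formed_rule_def subst_fterm_def)
  next
    case False
    then have "\<mu> x = Var x" using dom by (auto simp: subst_dom_def)
    moreover have "\<exists>n. total_ext \<sigma> x = Some n"
      using dom_total_ext[of \<sigma>] by blast
    ultimately show ?thesis by auto
  qed
  then obtain h :: "'v \<Rightarrow> int" where h: "\<And>x. aeval (total_ext \<sigma>) (\<mu> x) = Some (real_of_int (h x))"
    by metis
  define \<tau> where "\<tau> = (\<lambda>x. Some (h x))"
  have ev: "\<And>x. aeval (total_ext \<sigma>) (\<mu> x) = map_option real_of_int (\<tau> x)"
    by (simp add: \<tau>_def h)
  have "dom \<tau> = UNIV" by (auto simp: \<tau>_def)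
  moreover have "ineq_holds \<tau> q" if "q \<in> set (guard \<beta>)" for q
    using guards'[of "subst_ineq \<mu> q"] that ineq_holds_subst_ineq[OF ev]
    by (simp add: chain_rule_def subst_constraint_def)
  ultimately have "models_rule xs \<tau> \<beta>" "dom \<tau> = UNIV"
    by (simp_all add: models_rule_def constraint_holds_def)
  then show thesis using m1 ev that by blast
qed

text \<open>A step with the chained rule evaluates its right-hand side under \<open>\<sigma>\<close>
  itself. The expressions there have all their variables in the domain of \<open>\<sigma>\<close>,
  so the extension may replace it and the substitution lemma applies.\<close>

lemma aeval_rhs_chain_rule:
  assumes "vars_rule xs (chain_rule \<mu> \<alpha> \<beta>) \<subseteq> dom \<sigma>"
    and "\<And>x. aeval (total_ext \<sigma>) (\<mu> x) = map_option real_of_int (\<tau> x)"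
    and "(g, ts) \<in># rhs \<beta>" and "e \<in> set ts"
  shows "aeval \<sigma> (subst_aexp \<mu> e) = aeval \<tau> e"
proof -
  have "vars_aexp (subst_aexp \<mu> e) \<subseteq> dom \<sigma>"
    using assms(1,4)
      bspec[OF _ assms(3), of "\<lambda>t. \<forall>e \<in> set (snd t). vars_aexp (subst_aexp \<mu> e) \<subseteq> dom \<sigma>"]
    by (simp add: vars_rule_def chain_rule_def subst_fterm_def UN_subset_iff)
  then have "aeval \<sigma> (subst_aexp \<mu> e) = aeval (total_ext \<sigma>) (subst_aexp \<mu> e)"
    by (simp add: aeval_total_ext)
  also have "\<dots> = aeval \<tau> e" by (rule aeval_subst_aexp[OF assms(2)])
  finally show ?thesis .
qed

text \<open>Each argument has the value of the corresponding argument of \<open>\<beta>\<close>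
  under \<open>\<tau>\<close>, which is an integer because \<open>\<tau>\<close> models
  \<open>\<beta>\<close>.\<close>

lemma well_formed_chain_rule:
  assumes wf: "well_formed_rule xs \<alpha>" "well_formed_rule xs \<beta>"
    and rhs: "rhs \<alpha> = {#subst_fterm \<mu> (g, map Var xs)#}"
    and dom: "subst_dom \<mu> \<subseteq> set xs"
  shows "well_formed_rule xs (chain_rule \<mu> \<alpha> \<beta>)"
  unfolding well_formed_rule_def
proof (intro allI impI)
  fix \<sigma> assume mod: "models_rule xs \<sigma> (chain_rule \<mu> \<alpha> \<beta>)"
  then obtain \<tau> where \<tau>: "models_rule xs \<tau> \<beta>"
    "\<And>x. aeval (total_ext \<sigma>) (\<mu> x) = map_option real_of_int (\<tau> x)"
    using models_chain_ruleE[OF wf(1) rhs dom] by metis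
  have vars: "vars_rule xs (chain_rule \<mu> \<alpha> \<beta>) \<subseteq> dom \<sigma>"
    using mod by (simp add: models_rule_def)
  have "\<exists>n :: int. aeval \<sigma> (subst_aexp \<mu> e) = Some (real_of_int n)"
    if "(h, ts) \<in># rhs \<beta>" "e \<in> set ts" for h ts e
    using aeval_rhs_chain_rule[OF vars \<tau>(2) that] wf(2) \<tau>(1) that
    by (fastforce simp: well_formed_rule_def)
  then show "\<forall>(g, ts) \<in># rhs (chain_rule \<mu> \<alpha> \<beta>). \<forall>t \<in> set ts.
      \<exists>n :: int. aeval \<sigma> t = Some (real_of_int n)"
    by (auto simp: chain_rule_def subst_fterm_def)
qed

lemma steps_two:
  assumes "step xs P S k T" and "step xs P T l U"
  shows "steps xs P S (k + l) U"
  using steps_step[OF assms(1) steps_step[OF assms(2) steps_refl]] by simp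

lemma steps_trans: "steps xs P S k T \<Longrightarrow> steps xs P T l U \<Longrightarrow> steps xs P S (k + l) U"
  by (induction rule: steps.induct) (auto simp: add.assoc intro: steps_step)

lemma step_chain_rule:
  assumes wf: "well_formed_rule xs \<alpha>"
    and rhs: "rhs \<alpha> = {#subst_fterm \<mu> (root \<beta>, map Var xs)#}"
    and dom: "subst_dom \<mu> \<subseteq> set xs"
    and P: "\<alpha> \<in> P" "\<beta> \<in> P"
    and step: "step xs {chain_rule \<mu> \<alpha> \<beta>} S k T"
  shows "steps xs P S k T"
proof -
  from step obtain s \<sigma> Q where s: "s \<in># S" and root: "root \<alpha> = fst s"
    and args: "map \<sigma> xs = map Some (snd s)"
    and mod: "models_rule xs \<sigma> (chain_rule \<mu> \<alpha> \<beta>)"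
    and cost: "aeval \<sigma> (Add (cost \<alpha>) (subst_aexp \<mu> (cost \<beta>))) = Some k"
    and Q: "image_mset (\<lambda>(g, ts). (g, map (aeval \<sigma>) ts)) (image_mset (subst_fterm \<mu>) (rhs \<beta>)) =
          image_mset (\<lambda>(g, ns). (g, map (\<lambda>n. Some (real_of_int n)) ns)) Q"
    and T: "T = S - {#s#} + Q"
    unfolding step_def by (auto simp: chain_rule_def)
  obtain \<tau> where m1: "models_rule xs (total_ext \<sigma>) \<alpha>" and m2: "models_rule xs \<tau> \<beta>"
    and ev: "\<And>x. aeval (total_ext \<sigma>) (\<mu> x) = map_option real_of_int (\<tau> x)"
    and dom\<tau>: "dom \<tau> = UNIV"
    using models_chain_ruleE[OF wf rhs dom mod] by metis
  have vars: "vars_rule xs (chain_rule \<mu> \<alpha> \<beta>) \<subseteq> dom \<sigma>"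
    using mod by (simp add: models_rule_def)
  \<comment> \<open>The arguments of the intermediate term, which the first step produces and the
    second one consumes.\<close>
  define ns where "ns = map (\<lambda>x. the (\<tau> x)) xs"
  have \<tau>_the: "\<tau> x = Some (the (\<tau> x))" for x
    using dom\<tau> by (metis UNIV_I domIff option.collapse)
  have \<tau>_xs: "map \<tau> xs = map Some ns"
    using \<tau>_the by (simp add: ns_def)
  have "map (total_ext \<sigma>) xs = map \<sigma> xs"
    using vars by (auto simp: vars_rule_def intro!: total_ext_eq)
  with args have args': "map (total_ext \<sigma>) xs = map Some (snd s)" by simp
  \<comment> \<open>A sum has a value only if both summands do, so the cost splits into the costs of
    the two steps.\<close>
  obtain k1 k2 where k1: "aeval \<sigma> (cost \<alpha>) = Some k1"
    and k2: "aeval \<sigma> (subst_aexp \<mu> (cost \<beta>)) = Some k2" and k: "k = k1 + k2"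
    using cost by (auto simp: lift2_def bind_eq_Some_conv)
  have "vars_aexp (cost \<alpha>) \<subseteq> dom \<sigma>" "vars_aexp (subst_aexp \<mu> (cost \<beta>)) \<subseteq> dom \<sigma>"
    using vars by (auto simp: vars_rule_def chain_rule_def)
  then have k1': "aeval (total_ext \<sigma>) (cost \<alpha>) = Some k1" and k2': "aeval \<tau> (cost \<beta>) = Some k2"
    using k1 k2 by (simp_all add: aeval_total_ext flip: aeval_subst_aexp[OF ev])
  have arg_eval: "aeval (total_ext \<sigma>) (\<mu> x) = Some (real_of_int (the (\<tau> x)))" for x
    using ev[of x] \<tau>_the[of x] by (metis option.simps(9))
  have step1: "step xs P S k1 (S - {#s#} + {#(root \<beta>, ns)#})"
    unfolding step_def
    by (rule bexI[OF _ s], rule bexI[OF _ P(1)], rule exI[of _ "total_ext \<sigma>"],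
        rule exI[of _ "{#(root \<beta>, ns)#}"])
      (simp add: root args' m1 k1' rhs subst_fterm_def ns_def arg_eval)
  \<comment> \<open>Both instances of the right-hand side agree, so the same \<open>Q\<close> serves
    for the second step.\<close>
  have "image_mset (\<lambda>(g, ts). (g, map (aeval \<tau>) ts)) (rhs \<beta>) =
      image_mset (\<lambda>(g, ts). (g, map (aeval \<sigma>) ts)) (image_mset (subst_fterm \<mu>) (rhs \<beta>))"
    using aeval_rhs_chain_rule[OF vars ev]
    by (auto simp: multiset.map_comp subst_fterm_def intro!: image_mset_cong)
  then have step2: "step xs P (S - {#s#} + {#(root \<beta>, ns)#}) k2 T"
    unfolding step_def
    by (intro bexI[of _ "(root \<beta>, ns)"] bexI[OF _ P(2)] exI[of _ \<tau>] exI[of _ Q])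
      (simp_all add: \<tau>_xs m2 k2' Q T)
  show ?thesis using steps_two[OF step1 step2] by (simp add: k)
qed

lemma step_Un: "step xs (P \<union> R) S k T \<longleftrightarrow> step xs P S k T \<or> step xs R S k T"
  unfolding step_def by blast

lemma steps_simulation:
  assumes "\<And>S k T. step xs R S k T \<Longrightarrow> steps xs P S k T"
  shows "steps xs R S k T \<Longrightarrow> steps xs P S k T"
  by (induction rule: steps.induct) (auto intro: steps_refl steps_trans assms)

text \<open>Simulating every single step by a sequence of equal cost gives an inclusion of the sets
  of reachable costs, hence an inequality of their suprema.\<close>

lemma rc_mono:
  assumes "\<And>S k T. step xs R S k T \<Longrightarrow> steps xs P S k T"
  shows "rc f0 xs R n \<le> rc f0 xs P n"
proof -
  have dh: "dh xs R S \<le> dh xs P S" for S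
    unfolding dh_def using steps_simulation[OF assms] by (intro Sup_subset_mono) blast
  show ?thesis
    unfolding rc_def by (rule Sup_mono) (use dh in blast)
qed

theorem theorem3p18:
  fixes Sig :: "'f set" and f0 f1 f2 :: 'f and xs :: "'v list"
    and P P' :: "('f, 'v) program"
    and \<alpha>1 \<alpha>2 \<alpha>12 :: "('f, 'v) rule"
    and c1 c2 :: "'v aexp" and \<phi>1 \<phi>2 :: "'v constraint"
    and t :: "('f, 'v) fterm" and \<mu> :: "'v subst"
  assumes "finite Sig" and "f0 \<in> Sig" and "distinct xs"
    and "integer_program Sig f0 xs P"
    and "well_formed xs P"
    and "tail_recursive P"
    and "\<alpha>1 \<in> P" and "\<alpha>2 \<in> P"
    and "subst_dom \<mu> \<subseteq> set xs"
    and "\<alpha>1 = Rule f1 c1 {#subst_fterm \<mu> (f2, map Var xs)#} \<phi>1"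
    and "\<alpha>2 = Rule f2 c2 {#t#} \<phi>2"
    and "temp_vars xs \<alpha>1 \<inter> temp_vars xs \<alpha>2 = {}"
    and "\<alpha>12 = Rule f1 (Add c1 (subst_aexp \<mu> c2)) {#subst_fterm \<mu> t#}
                 (\<phi>1 @ subst_constraint \<mu> \<phi>2)"
    and "P' = P \<union> {\<alpha>12}"
  shows "well_formed xs P' \<and>
    processor Sig f0 xs [P \<mapsto> P'] \<and> sound_processor f0 xs [P \<mapsto> P']"
proof -
  have \<alpha>12: "\<alpha>12 = chain_rule \<mu> \<alpha>1 \<alpha>2"
    using assms(10,11,13) by (simp add: chain_rule_def)
  have rhs1: "rhs \<alpha>1 = {#subst_fterm \<mu> (root \<alpha>2, map Var xs)#}"
    using assms(10,11) by simp
  have wf: "well_formed_rule xs \<alpha>1" "well_formed_rule xs \<alpha>2"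
    using assms(5,7,8) by (auto simp: well_formed_def)
  have "well_formed xs P'"
    using well_formed_chain_rule[OF wf rhs1 assms(9)] assms(5,14) \<alpha>12
    by (auto simp: well_formed_def)
  \<comment> \<open>Substitution changes neither the function symbols nor the number of arguments on
    the right-hand side.\<close>
  moreover have "integer_program Sig f0 xs P'"
  proof -
    have "root \<alpha>1 \<in> Sig" "\<forall>(g, ts) \<in># rhs \<alpha>2. g \<in> Sig \<and> g \<noteq> f0 \<and> length ts = length xs"
      using assms(4,7,8) by (auto simp: integer_program_def)
    then have "root \<alpha>12 \<in> Sig"
      "\<forall>(g, ts) \<in># rhs \<alpha>12. g \<in> Sig \<and> g \<noteq> f0 \<and> length ts = length xs"
      by (auto simp: \<alpha>12 chain_rule_def subst_fterm_def)
    then show ?thesis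
      using assms(4,14) by (simp add: integer_program_def)
  qed
  then have "processor Sig f0 xs [P \<mapsto> P']"
    using assms(4) by (auto simp: processor_def split: if_splits)
  \<comment> \<open>An old rule yields a sequence of length one, the chained rule one of length
    two.\<close>
  moreover have "steps xs P S k T" if "step xs P' S k T" for S k T
    using that step_chain_rule[OF wf(1) rhs1 assms(9,7,8)]
      steps_step[OF _ steps_refl, of xs P S k T]
    unfolding assms(14) \<alpha>12 step_Un by auto
  then have "sound_processor f0 xs [P \<mapsto> P']"
    using rc_mono[of xs P' P] by (simp add: sound_processor_def)
  ultimately show ?thesis by blast
qed

end
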